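(* Let $N=\{1,\dots,n\}$ be the set of buyers and $M=\{1,\dots,m\}$ the set of goods, with $n>m$. Suppose there are linear functions $w_i,f_i:\mathbb R\to\mathbb R$ $(i\in N)$, with every $w_i$ strictly increasing, such that: (1) each buyer's valuation of a nonempty set of goods equals the valuation of the highest-valued good in the set: $v_{i,S}=\max_{K\in S}v_{i,K}$; (2) $v_{i,K}(s_{1K},\dots,s_{nK})=w_i(s_{iK})+\sum_{j\ne i}f_j(s_{jK})$ for all $i\in N$, $K\in M$, $(s_{1K},\dots,s_{nK})\in\mathbb R^n$; (3) $w_i'>f_i'$ for all $i\in N$; (4) all valuations are nonnegative at the buyers' true signals; (5) for every $i\in N$ there are constants $c_i>1$ and $d_i\in\mathbb R$ with $w_i(x)=c_if_i(x)+d_i$ for all $x\in\mathbb R$; (6) each $f_i$ is injective with image $\mathbb R$. Then truthful bidding is a Nash equilibrium of Auction 4 (defined in the context), and Auction 4 is efficient.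
   Context: "Linear" means of the form $x\mapsto ax+b$. Buyer $i$ privately observes one signal $s_{iA}\in\mathbb R$ for each good $A$; $v_{i,A}$ (also written $v_{iA}$) is a function of $s_A=(s_{1A},\dots,s_{nA})\in\mathbb R^n$. Each buyer knows all valuation functions but only his or her own signals; the auction designer knows neither the signals nor the valuation functions. A buyer who receives a set $S$ of goods (with $v_{i,\emptyset}=0$) and pays $P$ has utility $v_{i,S}-P$, valuation evaluated at the true signals. The welfare of an allocation is the sum over buyers of their valuations of the sets they receive. Auction 4: (Bidding) For every good $A$, every buyer $i$ submits a function $b_{iA}:\mathbb R^{n-1}\to\mathbb R$ of the form $b_{iA}(v_{-i})=x_{ii}^{(A)}+\sum_{j\ne i}x_{ij}^{(A)}v_j$ with real coefficients, where $v_{-i}=(v_j)_{j\neq i}$. (Allocation) The goods are allocated if and only if $x_{ij}^{(A)}\neq0$ for all $A\in M$ and all $i\ne j$, and for every $j\in N$ there is $c_j'>1$ such that $$\frac1{x_{ij}^{(A)}}\Big(1-\sum_{t\ne i,j}x_{it}^{(A)}\Big)=c_j'\quad\text{for all }A\in M\text{ and all }i\in N,\ i\ne j.$$ (Otherwise no good is allocated and nobody pays.) In this case, for each $A$ let $v_A^\circ=(v_{1A}^\circ,\dots,v_{nA}^\circ)$ be the (unique) fixed point: $b_{iA}\big((v_{jA}^\circ)_{j\ne i}\big)=v_{iA}^\circ$ for all $i\in N$. Treating $v_{iA}^\circ$ as buyer $i$'s valuation of good $A$, choose a welfare-maximizing allocation among the allocations of all goods of $M$ in which each buyer receives at most one good;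 let $i_A$ be the buyer receiving good $A$. The goods are given out according to this allocation. (Payment) A buyer who receives no good pays nothing. If buyer $i$ receives good $A$, take a welfare-maximizing allocation (again treating the $v^\circ$ as valuations and with at most one good per buyer) of the goods of $M$ to the buyers in $N\setminus\{i\}$, and let $j_K$ be the buyer receiving good $K$ in it. Consider the value $x_{ii}^{A*}$ which, when it replaces $x_{ii}^{(A)}$ in buyer $i$'s bid for good $A$ (all other coefficients unchanged), yields a fixed point $v_A^*=(v_{1A}^*,\dots,v_{nA}^* )$ of the bid functions for good $A$ satisfying $$v_{iA}^*+\sum_{K\ne A}v_{i_KK}^\circ=v_{j_AA}^*+\sum_{K\ne A}v_{j_KK}^\circ.$$ Buyer $i$ pays $v_{iA}^*$. Truthful bidding: buyer $i$ with signals $s_{iA}$ submits, for each $A$, the function $b_{iA}:\mathbb R^{n-1}\to\mathbb R$ of the form $b_{iA}(v_{-i})=x_{ii}^{(A)}+\sum_{j\ne i}x_{ij}^{(A)}v_j$ with real coefficients such that $b_{iA}\big((v_{jA}(s_A))_{j\ne i}\big)=v_{iA}(s_A)$ for all $s_A\in\mathbb R^n$ whose $i$-th coordinate is the actual $s_{iA}$, the other coordinates being arbitrary (such a function exists and is unique). Nash equilibrium (of pure strategies): at every profile of true signals satisfying the hypotheses, for every buyer $i$, if all other buyers follow their prescribed strategies, then no bid of buyer $i$ gives buyer $i$ a strictly higher utility than the prescribed one. The auction is efficient if there is a Nash equilibrium whose resulting allocation maximizes welfare (at the true signals) among all allocations of the goods to the buyers. *)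

theory Defs
  imports "HOL-Analysis.Analysis"
begin

text \<open>
  The buyers are the elements of a finite type \<open>'b\<close>, the goods those of a finite type \<open>'g\<close>.
  A signal profile is \<open>s :: 'b \<Rightarrow> 'g \<Rightarrow> real\<close>, where \<open>s i K\<close> is the signal of buyer \<open>i\<close> for good
  \<open>K\<close>; so \<open>s i\<close> is what buyer \<open>i\<close> observes, and \<open>\<lambda>i. s i K\<close> is the vector on which the
  valuations of good \<open>K\<close> depend.
\<close>

definition linear_fun :: "(real \<Rightarrow> real) \<Rightarrow> bool" where
  "linear_fun g \<longleftrightarrow> (\<exists>a b. \<forall>x. g x = a * x + b)"


subsection \<open>Auctions, equilibria, efficiency\<close>

text \<open>An auction maps a profile of bids to the sets of goods received and the payments made.\<close>

type_synonym ('b, 'g, 'bid) auction = "('b \<Rightarrow> 'bid) \<Rightarrow> ('b \<Rightarrow> 'g set) \<times> ('b \<Rightarrow> real)"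

text \<open>Set valuations: \<open>V i S s\<close> is buyer \<open>i\<close>'s valuation of the set \<open>S\<close> at the signals \<open>s\<close>.\<close>

type_synonym ('b, 'g) set_valuation = "'b \<Rightarrow> 'g set \<Rightarrow> ('b \<Rightarrow> 'g \<Rightarrow> real) \<Rightarrow> real"

definition utility ::
  "('b, 'g) set_valuation \<Rightarrow> ('b \<Rightarrow> 'g \<Rightarrow> real) \<Rightarrow> ('b \<Rightarrow> 'g set) \<times> ('b \<Rightarrow> real) \<Rightarrow> 'b \<Rightarrow> real"
where
  "utility V s r i = V i (fst r i) s - snd r i"

definition welfare ::
  "('b::finite, 'g) set_valuation \<Rightarrow> ('b \<Rightarrow> 'g \<Rightarrow> real) \<Rightarrow> ('b \<Rightarrow> 'g set) \<Rightarrow> real"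
where
  "welfare V s S = (\<Sum>i\<in>UNIV. V i (S i) s)"

text \<open>
  A strategy of buyer \<open>i\<close> is a function of the own signals \<open>s i\<close> only. The equilibrium is ex post:
  \<open>T\<close> is the set of possible profiles of true signals.
\<close>

definition nash_equilibrium ::
  "('b, 'g, 'bid) auction \<Rightarrow> ('b, 'g) set_valuation \<Rightarrow> ('b \<Rightarrow> 'g \<Rightarrow> real) set \<Rightarrow>
   ('b \<Rightarrow> ('g \<Rightarrow> real) \<Rightarrow> 'bid) \<Rightarrow> bool"
where
  "nash_equilibrium auc V T \<sigma> \<longleftrightarrow>
     (\<forall>s\<in>T. \<forall>i b. utility V s (auc ((\<lambda>k. \<sigma> k (s k))(i := b))) i
                 \<le> utility V s (auc (\<lambda>k. \<sigma> k (s k))) i)"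

text \<open>An allocation gives disjoint sets of goods to the buyers; goods may stay unallocated.\<close>

definition efficient ::
  "('b::finite, 'g, 'bid) auction \<Rightarrow> ('b, 'g) set_valuation \<Rightarrow> ('b \<Rightarrow> 'g \<Rightarrow> real) set \<Rightarrow> bool"
where
  "efficient auc V T \<longleftrightarrow>
     (\<exists>\<sigma>. nash_equilibrium auc V T \<sigma> \<and>
          (\<forall>s\<in>T. is_arg_max (welfare V s) disjoint_family (fst (auc (\<lambda>k. \<sigma> k (s k))))))"


subsection \<open>The bids\<close>

text \<open>
  A bid of buyer \<open>i\<close> is given by its coefficients: for \<open>b :: ('b, 'g) bid\<close>, the number \<open>b A j\<close> is
  $x_{ij}^{(A)}$, and in particular \<open>b A i\<close> is the constant term $x_{ii}^{(A)}$. The function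
  below does not depend on the \<open>i\<close>-th component of \<open>v\<close>.
\<close>

type_synonym ('b, 'g) bid = "'g \<Rightarrow> 'b \<Rightarrow> real"

definition bid_fun :: "'b::finite \<Rightarrow> ('b \<Rightarrow> real) \<Rightarrow> ('b \<Rightarrow> real) \<Rightarrow> real" where
  "bid_fun i c v = c i + (\<Sum>j\<in>UNIV - {i}. c j * v j)"

definition is_truthful_bid ::
  "('b::finite \<Rightarrow> 'g \<Rightarrow> ('b \<Rightarrow> real) \<Rightarrow> real) \<Rightarrow> 'b \<Rightarrow> ('g \<Rightarrow> real) \<Rightarrow> ('b, 'g) bid \<Rightarrow> bool"
where
  "is_truthful_bid v i si b \<longleftrightarrow>
     (\<forall>A t. t i = si A \<longrightarrow> bid_fun i (b A) (\<lambda>j. v j A t) = v i A t)"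

definition truthful ::
  "('b::finite \<Rightarrow> 'g \<Rightarrow> ('b \<Rightarrow> real) \<Rightarrow> real) \<Rightarrow> 'b \<Rightarrow> ('g \<Rightarrow> real) \<Rightarrow> ('b, 'g) bid"
where
  "truthful v i si = (THE b. is_truthful_bid v i si b)"


subsection \<open>Auction 4\<close>

text \<open>For a bid profile \<open>x\<close>, the number \<open>x i A j\<close> is $x_{ij}^{(A)}$.\<close>

definition goods_sold :: "('b::finite \<Rightarrow> ('b, 'g) bid) \<Rightarrow> bool" where
  "goods_sold x \<longleftrightarrow>
     (\<forall>A i j. i \<noteq> j \<longrightarrow> x i A j \<noteq> 0) \<and>
     (\<forall>j. \<exists>c>1. \<forall>A i. i \<noteq> j \<longrightarrow> 1 / x i A j * (1 - (\<Sum>t\<in>UNIV - {i, j}. x i A t)) = c)"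

text \<open>Here \<open>c i j\<close> are the coefficients of all bids for one fixed good.\<close>

definition is_fixed_point :: "('b::finite \<Rightarrow> 'b \<Rightarrow> real) \<Rightarrow> ('b \<Rightarrow> real) \<Rightarrow> bool" where
  "is_fixed_point c v \<longleftrightarrow> (\<forall>i. bid_fun i (c i) v = v i)"

definition reported_value :: "('b::finite \<Rightarrow> ('b, 'g) bid) \<Rightarrow> 'b \<Rightarrow> 'g \<Rightarrow> real" where
  "reported_value x i A = (THE v. is_fixed_point (\<lambda>k. x k A) v) i"

text \<open>
  An allocation of all goods to buyers in \<open>B\<close>, with at most one good per buyer, is an injective
  function \<open>a\<close> from goods to buyers with range in \<open>B\<close>. Its welfare, the sum of the buyers' values
  of the good they receive, is then the sum over the goods \<open>K\<close> of the value for buyer \<open>a K\<close>.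
\<close>

definition optimal_assignment ::
  "'b set \<Rightarrow> ('b \<Rightarrow> 'g::finite \<Rightarrow> real) \<Rightarrow> ('g \<Rightarrow> 'b) \<Rightarrow> bool"
where
  "optimal_assignment B u a \<longleftrightarrow>
     is_arg_max (\<lambda>a. \<Sum>K\<in>UNIV. u (a K) K) (\<lambda>a. inj a \<and> range a \<subseteq> B) a"

text \<open>
  The auction does not say which welfare-maximizing allocation is chosen. This is made a parameter:
  \<open>\<tau> B x\<close> is the one chosen for the set \<open>B\<close> of buyers when the bid profile is \<open>x\<close>.
\<close>

type_synonym ('b, 'g) selection = "'b set \<Rightarrow> ('b \<Rightarrow> ('b, 'g) bid) \<Rightarrow> 'g \<Rightarrow> 'b"

definition selection_rule :: "('b::finite, 'g::finite) selection \<Rightarrow> bool" where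
  "selection_rule \<tau> \<longleftrightarrow>
     (\<forall>B x. CARD('g) \<le> card B \<longrightarrow> optimal_assignment B (reported_value x) (\<tau> B x))"

definition price ::
  "('b::finite, 'g::finite) selection \<Rightarrow> ('b \<Rightarrow> ('b, 'g) bid) \<Rightarrow> 'b \<Rightarrow> 'g \<Rightarrow> real"
where
  "price \<tau> x i A =
     (let u = reported_value x; a = \<tau> UNIV x; a' = \<tau> (UNIV - {i}) x in
      THE p. \<exists>y z. is_fixed_point ((\<lambda>k. x k A)(i := (x i A)(i := y))) z \<and>
                   z i + (\<Sum>K\<in>UNIV - {A}. u (a K) K)
                     = z (a' A) + (\<Sum>K\<in>UNIV - {A}. u (a' K) K) \<and>
                   p = z i)"

definition auction4 :: "('b::finite, 'g::finite) selection \<Rightarrow> ('b, 'g, ('b, 'g) bid) auction" where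
  "auction4 \<tau> x =
     (if goods_sold x
      then (\<lambda>i. {A. \<tau> UNIV x A = i},
            \<lambda>i. if \<exists>A. \<tau> UNIV x A = i then price \<tau> x i (THE A. \<tau> UNIV x A = i) else 0)
      else (\<lambda>i. {}, \<lambda>i. 0))"

end

theory Submission
  imports Defs
begin

text \<open>
  Fix a buyer \<open>i\<close> and let the others bid truthfully. For each good, the fixed points of the others'
  bid functions form the line of the true values plus \<open>\<delta>\<close> times the vector that is \<open>c i\<close> at \<open>i\<close> and
  \<open>1\<close> elsewhere, whatever buyer \<open>i\<close> bids; the sold condition makes \<open>\<delta>\<close> unique. The values of the
  other buyers are thus all shifted by the same amount, so an optimal assignment without buyer \<open>i\<close> is
  also optimal for the true values. Solving the price equation on this line, the utility of buyer \<open>i\<close>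
  when winning is \<open>c i / (c i - 1)\<close> times the true welfare of the chosen assignment minus the optimal
  true welfare without \<open>i\<close>. Truthful bids give \<open>\<delta> = 0\<close>, hence an assignment of maximal true welfare,
  which maximizes this utility. As the values are nonnegative and there are more buyers than goods,
  no allocation of sets of goods does better than an optimal one-good-per-buyer assignment.
\<close>

section \<open>Optimal assignments and the sold condition\<close>

lemma sum_but_one:
  fixes g :: "'b::finite \<Rightarrow> real"
  shows "sum g (UNIV - {i}) = sum g UNIV - g i"
  by (simp add: sum_diff1)

lemma is_arg_max_iff:
  fixes F :: "'a \<Rightarrow> real"
  shows "is_arg_max F P x \<longleftrightarrow> P x \<and> (\<forall>y. P y \<longrightarrow> F y \<le> F x)"
  by (auto simp: is_arg_max_def not_less)

lemma optimal_assignment_iff: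
  "optimal_assignment B u a \<longleftrightarrow>
     inj a \<and> range a \<subseteq> B \<and>
     (\<forall>b. inj b \<and> range b \<subseteq> B \<longrightarrow> (\<Sum>K\<in>UNIV. u (b K) K) \<le> (\<Sum>K\<in>UNIV. u (a K) K))"
  by (simp add: optimal_assignment_def is_arg_max_iff)

text \<open>All goods are assigned, so a shift that depends on the good only changes every welfare equally.\<close>

lemma optimal_assignment_shift:
  assumes "\<And>j K. j \<in> B \<Longrightarrow> u' j K = u j K + r K"
  shows "optimal_assignment B u' a \<longleftrightarrow> optimal_assignment B u a"
proof -
  have "(\<Sum>K\<in>UNIV. u' (b K) K) = (\<Sum>K\<in>UNIV. u (b K) K) + sum r UNIV" if "range b \<subseteq> B" for b
    using that assms by (simp add: image_subset_iff flip: sum.distrib)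
  then show ?thesis
    by (auto simp: optimal_assignment_iff)
qed

lemma inj_on_extend_inj:
  fixes g :: "'g::finite \<Rightarrow> 'b::finite"
  assumes "inj_on g D" "CARD('g) \<le> CARD('b)"
  obtains h where "inj h" "\<And>K. K \<in> D \<Longrightarrow> h K = g K"
proof -
  have "card (UNIV - D) \<le> card (UNIV - g ` D)"
    using assms by (simp add: card_Diff_subset card_image)
  then obtain e where e: "e ` (UNIV - D) \<subseteq> UNIV - g ` D" "inj_on e (UNIV - D)"
    using card_le_inj[of "UNIV - D" "UNIV - g ` D"] by auto
  let ?h = "\<lambda>K. if K \<in> D then g K else e K"
  have "inj ?h"
    using inj_on_disjoint_Un[OF assms(1) e(2)] e(1) by auto
  then show thesis
    by (rule that) simp
qed

lemma bid_fun_diff: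
  "bid_fun k b z = bid_fun k b y + (\<Sum>j\<in>UNIV - {k}. b j * (z j - y j))"
  by (simp add: bid_fun_def right_diff_distrib sum_subtractf)

text \<open>
  The sold condition says \<open>x i A j * (c' j - 1) = R\<close> with \<open>R\<close> one minus the sum below; if \<open>R\<close> were not
  positive, all these coefficients would be nonpositive and \<open>R\<close> at least one.
\<close>

lemma goods_sold_sum_less_1:
  assumes "goods_sold x"
  shows "(\<Sum>j\<in>UNIV - {i}. x i A j) < 1"
proof (rule ccontr)
  assume ge: "\<not> ?thesis"
  have "x i A j \<le> 0" if "j \<noteq> i" for j
  proof -
    have nz: "x i A j \<noteq> 0"
      using conjunct1[OF assms[unfolded goods_sold_def]] that by simp
    obtain c' where "c' > 1"
      and all: "\<And>A i. i \<noteq> j \<Longrightarrow> 1 / x i A j * (1 - (\<Sum>t\<in>UNIV - {i, j}. x i A t)) = c'"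
      using conjunct2[OF assms[unfolded goods_sold_def]] by blast
    note c' = \<open>c' > 1\<close> all[OF that[symmetric], of A]
    have "UNIV - {i} = insert j (UNIV - {i, j})"
      using that by auto
    then have "(\<Sum>t\<in>UNIV - {i}. x i A t) = x i A j + (\<Sum>t\<in>UNIV - {i, j}. x i A t)"
      by simp
    then have "x i A j * (c' - 1) = 1 - (\<Sum>t\<in>UNIV - {i}. x i A t)"
      using c'(2) nz by (simp add: divide_eq_eq algebra_simps)
    then have "x i A j * (c' - 1) \<le> 0"
      using ge by simp
    then show ?thesis
      using c'(1) by (simp add: mult_le_0_iff)
  qed
  then have "(\<Sum>j\<in>UNIV - {i}. x i A j) \<le> 0"
    by (intro sum_nonpos) auto
  with ge show False
    by simp
qed

section \<open>Welfare under unit demand\<close>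

lemma unit_demand_singleton:
  assumes "\<And>i S s. S \<noteq> {} \<Longrightarrow> V i S s = Max ((\<lambda>K. v i K (\<lambda>j. s j K)) ` S)"
  shows "V i {K} s = v i K (\<lambda>j. s j K)"
  using assms[of "{K}"] by simp

lemma unit_demand_assignment:
  fixes V :: "('b::finite, 'g::finite) set_valuation"
  assumes "\<And>i s. V i {} s = 0"
    and "\<And>i S s. S \<noteq> {} \<Longrightarrow> V i S s = Max ((\<lambda>K. v i K (\<lambda>j. s j K)) ` S)"
    and "inj a"
  shows "welfare V s (\<lambda>i. {A. a A = i}) = (\<Sum>K\<in>UNIV. v (a K) K (\<lambda>j. s j K))"
proof -
  have "welfare V s (\<lambda>i. {A. a A = i}) = (\<Sum>i\<in>range a. V i {A. a A = i} s)"
    unfolding welfare_def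
  proof (rule sum.mono_neutral_right)
    show "\<forall>i\<in>UNIV - range a. V i {A. a A = i} s = 0"
    proof
      fix i assume "i \<in> UNIV - range a"
      then have "{A. a A = i} = {}" by auto
      then show "V i {A. a A = i} s = 0" by (simp add: assms(1))
    qed
  qed auto
  also have "\<dots> = (\<Sum>K\<in>UNIV. V (a K) {A. a A = a K} s)"
    using assms(3) by (simp add: sum.reindex)
  also have "\<dots> = (\<Sum>K\<in>UNIV. v (a K) K (\<lambda>j. s j K))"
  proof (rule sum.cong)
    fix K
    have "{A. a A = a K} = {K}" using assms(3) by (simp add: inj_eq)
    then show "V (a K) {A. a A = a K} s = v (a K) K (\<lambda>j. s j K)"
      using unit_demand_singleton[of V v, OF assms(2)] by simp
  qed simp
  finally show ?thesis .
qed

text \<open>A buyer with a nonempty set values only one best good of it. Disjointness makes these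
  best goods distinct, so any allocation keeps its welfare when reduced to a partial
  one-good-per-buyer assignment. Completing that assignment cannot lower welfare, since values are
  nonnegative.\<close>

lemma optimal_assignment_welfare:
  fixes V :: "('b::finite, 'g::finite) set_valuation"
  assumes empty: "\<And>i s. V i {} s = 0"
    and unit: "\<And>i S s. S \<noteq> {} \<Longrightarrow> V i S s = Max ((\<lambda>K. v i K (\<lambda>j. s j K)) ` S)"
    and card: "CARD('g) \<le> CARD('b)"
    and nonneg: "\<And>i S. V i S s \<ge> 0"
    and opt: "optimal_assignment UNIV (\<lambda>i K. v i K (\<lambda>j. s j K)) a"
  shows "is_arg_max (welfare V s) disjoint_family (\<lambda>i. {A. a A = i})"
  unfolding is_arg_max_iff
proof (intro conjI allI impI)
  show "disjoint_family (\<lambda>i. {A. a A = i})"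
    by (auto simp: disjoint_family_on_def)
  fix S :: "'b \<Rightarrow> 'g set"
  assume disj: "disjoint_family S"
  let ?u = "\<lambda>i K. v i K (\<lambda>j. s j K)"
  define P where "P = {i. S i \<noteq> {}}"
  have "\<exists>K\<in>S i. V i (S i) s = ?u i K" if "i \<in> P" for i
  proof -
    have "Max (?u i ` S i) \<in> ?u i ` S i"
      using that by (intro Max_in) (auto simp: P_def)
    then have "V i (S i) s \<in> ?u i ` S i"
      using unit[of "S i" i s] that by (simp add: P_def)
    then show ?thesis
      by blast
  qed
  then obtain best where best: "\<And>i. i \<in> P \<Longrightarrow> best i \<in> S i"
      "\<And>i. i \<in> P \<Longrightarrow> V i (S i) s = ?u i (best i)"
    by metis
  have inj: "inj_on best P"
  proof (rule inj_onI)
    fix i j assume "i \<in> P" "j \<in> P" "best i = best j"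
    then have "best i \<in> S i \<inter> S j" using best(1)[of i] best(1)[of j] by simp
    then show "i = j" using disj by (auto simp: disjoint_family_on_def)
  qed
  have nonneg_u: "?u i K \<ge> 0" for i K
    using nonneg[of i "{K}"] unit_demand_singleton[of V v i K s, OF unit] by simp
  \<comment> \<open>\<open>h\<close> returns each best good to its buyer and hands the remaining
    goods to buyers not yet served.\<close>
  obtain h where h: "inj h" "\<And>K. K \<in> best ` P \<Longrightarrow> h K = the_inv_into P best K"
    using inj_on_extend_inj[OF inj_on_the_inv_into[OF inj] card] by blast
  have "welfare V s S = (\<Sum>i\<in>P. V i (S i) s)"
    unfolding welfare_def by (rule sum.mono_neutral_right) (auto simp: P_def empty)
  also have "\<dots> = (\<Sum>i\<in>P. ?u (h (best i)) (best i))"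
    by (rule sum.cong) (simp_all add: best(2) h(2) the_inv_into_f_f[OF inj])
  also have "\<dots> = (\<Sum>K\<in>best ` P. ?u (h K) K)"
    using inj by (simp add: sum.reindex)
  also have "\<dots> \<le> (\<Sum>K\<in>UNIV. ?u (h K) K)"
    by (rule sum_mono2) (simp_all add: nonneg_u)
  also have "\<dots> \<le> (\<Sum>K\<in>UNIV. ?u (a K) K)"
    using opt h(1) by (simp add: optimal_assignment_iff)
  also have "\<dots> = welfare V s (\<lambda>i. {A. a A = i})"
    using opt by (simp add: unit_demand_assignment[of V v, OF empty unit] optimal_assignment_iff)
  finally show "welfare V s S \<le> welfare V s (\<lambda>i. {A. a A = i})" .
qed

section \<open>Closed form and uniqueness of truthful bids\<close>

text \<open>The valuations with \<open>w i\<close> rewritten as \<open>c i * f i + d i\<close>.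
  Surjectivity of \<open>f i\<close> allows the contribution of one signal to be changed by any
  prescribed amount.\<close>

locale proportional_valuations =
  fixes f :: "'b::finite \<Rightarrow> real \<Rightarrow> real" and c d :: "'b \<Rightarrow> real"
    and v :: "'b \<Rightarrow> 'g::finite \<Rightarrow> ('b \<Rightarrow> real) \<Rightarrow> real"
  assumes c_gt_1: "c i > 1"
    and surj_f: "surj (f i)"
    and v_eq: "v i A t = c i * f i (t i) + d i + (\<Sum>j\<in>UNIV - {i}. f j (t j))"
begin

definition \<gamma> :: "'b \<Rightarrow> real" where
  "\<gamma> i = 1 / (c i - 1)"

definition \<Gamma> :: real where
  "\<Gamma> = (\<Sum>i\<in>UNIV. \<gamma> i)"

definition slope :: "'b \<Rightarrow> 'b \<Rightarrow> real" where
  "slope i j = \<gamma> j / (1 + \<Gamma> - \<gamma> i)"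

text \<open>
  By \<open>v_eq_total\<close>, the total \<open>F\<close> of the \<open>f j (t j)\<close> satisfies \<open>\<gamma> j * (v j - d j) = f j (t j) + \<gamma> j * F\<close>.
  Summing over \<open>j \<noteq> i\<close> expresses \<open>F\<close>, and with it \<open>v i\<close>, by the other values and \<open>f i (t i)\<close>.
\<close>

definition explicit_bid :: "'b \<Rightarrow> ('g \<Rightarrow> real) \<Rightarrow> ('b, 'g) bid" where
  "explicit_bid i si A =
     (slope i)(i := (c i - 1) * f i (si A) + d i
                    + (f i (si A) - (\<Sum>j\<in>UNIV - {i}. \<gamma> j * d j)) / (1 + \<Gamma> - \<gamma> i))"

lemma \<gamma>_pos: "\<gamma> i > 0"
  using c_gt_1[of i] by (simp add: \<gamma>_def)

lemma \<gamma>_c: "\<gamma> i * (c i - 1) = 1"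
  using c_gt_1[of i] by (simp add: \<gamma>_def)

lemma denom_pos: "1 + \<Gamma> - \<gamma> i > 0"
proof -
  have "\<gamma> i \<le> \<Gamma>"
    unfolding \<Gamma>_def by (rule member_le_sum) (auto intro: less_imp_le[OF \<gamma>_pos])
  then show ?thesis by simp
qed

lemma \<Gamma>_pos: "1 + \<Gamma> > 0"
  using denom_pos \<gamma>_pos by (meson add_pos_pos diff_gt_0_iff_gt less_trans)

lemma v_eq_total: "v i A t = (c i - 1) * f i (t i) + d i + (\<Sum>j\<in>UNIV. f j (t j))"
  by (simp add: v_eq sum_but_one algebra_simps)

lemma is_truthful_explicit_bid: "is_truthful_bid v i si (explicit_bid i si)"
  unfolding is_truthful_bid_def
proof (intro allI impI)
  fix A t
  assume ti: "t i = si A"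
  let ?F = "\<Sum>j\<in>UNIV. f j (t j)" and ?D = "\<Sum>j\<in>UNIV - {i}. \<gamma> j * d j" and ?N = "1 + \<Gamma> - \<gamma> i"
  have "\<gamma> j * v j A t = f j (t j) + \<gamma> j * ?F + \<gamma> j * d j" for j
    using \<gamma>_c[of j] unfolding v_eq_total by algebra
  then have "(\<Sum>j\<in>UNIV - {i}. \<gamma> j * v j A t)
      = (\<Sum>j\<in>UNIV - {i}. f j (t j)) + (\<Sum>j\<in>UNIV - {i}. \<gamma> j) * ?F + ?D"
    by (simp add: sum.distrib sum_distrib_right)
  then have S: "(\<Sum>j\<in>UNIV - {i}. \<gamma> j * v j A t) = ?N * ?F - f i (t i) + ?D"
    by (simp add: sum_but_one[of "\<lambda>j. f j (t j)"] sum_but_one[of \<gamma>] \<Gamma>_def algebra_simps)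
  have "(\<Sum>j\<in>UNIV - {i}. explicit_bid i si A j * v j A t)
      = (\<Sum>j\<in>UNIV - {i}. \<gamma> j * v j A t) / ?N"
    unfolding sum_divide_distrib
    by (rule sum.cong) (auto simp: explicit_bid_def slope_def)
  then show "bid_fun i (explicit_bid i si A) (\<lambda>j. v j A t) = v i A t"
    unfolding bid_fun_def S using denom_pos[of i] ti
    by (simp add: explicit_bid_def v_eq_total[of i] field_simps)
qed

text \<open>The difference \<open>e\<close> of two truthful bids is an affine function that vanishes
  at all values the others can have. Varying one signal at a time gives a homogeneous linear system
  for its coefficients, which has only the zero solution.\<close>

lemma truthful_bid_unique:
  assumes "is_truthful_bid v i si b" "is_truthful_bid v i si b'"
  shows "b = b'"
proof (intro ext)
  fix A j
  define e where "e = (\<lambda>j. b A j - b' A j)"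
  define E where "E = (\<Sum>j\<in>UNIV - {i}. e j)"
  have e0: "e i + (\<Sum>j\<in>UNIV - {i}. e j * v j A t) = 0" if "t i = si A" for t
  proof -
    have "bid_fun i (b A) (\<lambda>j. v j A t) = bid_fun i (b' A) (\<lambda>j. v j A t)"
      using assms that by (simp add: is_truthful_bid_def)
    then show ?thesis
      by (simp add: bid_fun_def e_def left_diff_distrib sum_subtractf)
  qed
  have e_k: "e k = - \<gamma> k * E" if "k \<noteq> i" for k
  proof -
    define t where "t = (\<lambda>_::'b. si A)"
    \<comment> \<open>The signal of buyer \<open>k\<close> is changed so that \<open>f k\<close>
      grows by 1. Then every value grows by 1, except that of buyer \<open>k\<close>, which grows by
      \<open>c k\<close>.\<close>
    obtain r where r: "f k r = f k (t k) + 1"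
      using surj_f[of k] by (metis surjD)
    define t' where "t' = t(k := r)"
    have "(\<Sum>j\<in>UNIV. f j (t' j)) - (\<Sum>j\<in>UNIV. f j (t j)) = (\<Sum>j\<in>UNIV. if j = k then 1 else 0)"
      unfolding sum_subtractf[symmetric] by (rule sum.cong) (auto simp: t'_def r)
    then have F: "(\<Sum>j\<in>UNIV. f j (t' j)) = (\<Sum>j\<in>UNIV. f j (t j)) + 1"
      by simp
    have dv: "v j A t' - v j A t = 1 + (if j = k then c k - 1 else 0)" for j
      unfolding v_eq_total F by (simp add: t'_def r algebra_simps)
    have "(\<Sum>j\<in>UNIV - {i}. e j * (v j A t' - v j A t)) = 0"
      using e0[of t] e0[of t'] that
      by (simp add: t'_def[symmetric] right_diff_distrib sum_subtractf) (simp add: t'_def t_def)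
    moreover have "(\<Sum>j\<in>UNIV - {i}. e j * (v j A t' - v j A t))
        = E + (\<Sum>j\<in>UNIV - {i}. if j = k then e k * (c k - 1) else 0)"
      unfolding dv E_def sum.distrib[symmetric] by (rule sum.cong) (auto simp: algebra_simps)
    ultimately have "E + e k * (c k - 1) = 0"
      using that by simp
    then show ?thesis
      using \<gamma>_c[of k] by algebra
  qed
  \<comment> \<open>Summing \<open>e_k\<close> over all \<open>k\<close> other than \<open>i\<close>
    closes the system into one equation for \<open>E\<close>.\<close>
  have "E = (\<Sum>k\<in>UNIV - {i}. - \<gamma> k * E)"
    unfolding E_def[symmetric] by (subst (1) E_def, rule sum.cong) (auto simp: e_k)
  also have "\<dots> = - (\<Gamma> - \<gamma> i) * E"
    unfolding \<Gamma>_def sum_but_one[of \<gamma>, symmetric] by (simp add: sum_negf sum_distrib_right)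
  finally have "E = - (\<Gamma> - \<gamma> i) * E" .
  then have "(1 + \<Gamma> - \<gamma> i) * E = 0"
    by (simp add: algebra_simps)
  then have "E = 0"
    using denom_pos[of i] by simp
  then have ek0: "e k = 0" if "k \<noteq> i" for k
    using e_k that by simp
  then have "e i = 0"
    using e0[of "\<lambda>_. si A"] by simp
  with ek0 show "b A j = b' A j"
    by (cases "j = i") (auto simp: e_def)
qed

lemma truthful_eq: "truthful v i si = explicit_bid i si"
  unfolding truthful_def
  using is_truthful_explicit_bid truthful_bid_unique by blast

lemma bid_fun_truthful:
  "bid_fun k (truthful v k (s k) A) (\<lambda>j. v j A (\<lambda>l. s l A)) = v k A (\<lambda>l. s l A)"
  using is_truthful_explicit_bid[of k "s k"] by (simp add: truthful_eq is_truthful_bid_def)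

lemma truthful_slope: "j \<noteq> i \<Longrightarrow> truthful v i si A j = slope i j"
  by (simp add: truthful_eq explicit_bid_def)

text \<open>Both the coefficient of \<open>v j\<close> and the bracket in the sold condition have
  denominator \<open>1 + \<Gamma> - \<gamma> i\<close>. It cancels and leaves
  \<open>(1 + \<gamma> j) / \<gamma> j = c j\<close>, which depends neither on the good nor on the
  bidder.\<close>

lemma goods_sold_truthful: "goods_sold (\<lambda>k. truthful v k (s k))"
  unfolding goods_sold_def
proof (intro conjI allI impI)
  fix A and i j :: 'b
  assume "i \<noteq> j"
  then show "truthful v i (s i) A j \<noteq> 0"
    using \<gamma>_pos[of j] denom_pos[of i] by (simp add: truthful_slope slope_def)
next
  fix j
  have "1 / truthful v i (s i) A j * (1 - (\<Sum>t\<in>UNIV - {i, j}. truthful v i (s i) A t)) = c j"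
    if "i \<noteq> j" for A i
  proof -
    let ?N = "1 + \<Gamma> - \<gamma> i"
    have "(\<Sum>t\<in>UNIV - {i, j}. truthful v i (s i) A t) = (\<Sum>t\<in>UNIV - {i, j}. \<gamma> t) / ?N"
      unfolding sum_divide_distrib
      by (rule sum.cong) (auto simp: truthful_slope slope_def)
    also have "(\<Sum>t\<in>UNIV - {i, j}. \<gamma> t) = \<Gamma> - \<gamma> i - \<gamma> j"
    proof -
      have "UNIV - {i, j} = UNIV - {i} - {j}"
        by auto
      then show ?thesis
        using that by (simp add: sum_diff1 \<Gamma>_def)
    qed
    finally have "1 - (\<Sum>t\<in>UNIV - {i, j}. truthful v i (s i) A t) = (1 + \<gamma> j) / ?N"
      using denom_pos[of i] by (simp add: field_simps)
    then have "1 / truthful v i (s i) A j * (1 - (\<Sum>t\<in>UNIV - {i, j}. truthful v i (s i) A t))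
        = (1 + \<gamma> j) / \<gamma> j"
      using that denom_pos[of i] \<gamma>_pos[of j] by (simp add: truthful_slope slope_def)
    also have "\<dots> = c j"
      using c_gt_1[of j] by (simp add: \<gamma>_def field_simps)
    finally show ?thesis .
  qed
  then show "\<exists>c'>1. \<forall>A i. i \<noteq> j \<longrightarrow>
      1 / truthful v i (s i) A j * (1 - (\<Sum>t\<in>UNIV - {i, j}. truthful v i (s i) A t)) = c'"
    using c_gt_1 by blast
qed

section \<open>Fixed points when at most one buyer deviates\<close>

text \<open>
  Whatever buyer \<open>i\<close> bids, the fixed point lies on the line of those value profiles that result from
  changing only the signal of buyer \<open>i\<close>.
\<close>

definition shifted :: "('b \<Rightarrow> 'g \<Rightarrow> real) \<Rightarrow> 'b \<Rightarrow> 'g \<Rightarrow> real \<Rightarrow> 'b \<Rightarrow> real" where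
  "shifted s i A \<delta> j = v j A (\<lambda>l. s l A) + (if j = i then c i else 1) * \<delta>"

text \<open>In terms of the deviation \<open>u\<close> from the true values, the equation of buyer
  \<open>k\<close> becomes \<open>(1 + \<Gamma>) * u k = U\<close> with a common right-hand side. So
  all \<open>u k\<close> with \<open>k\<close> other than \<open>i\<close> equal one
  \<open>\<delta>\<close>, and the definition of \<open>U\<close> together with
  \<open>\<gamma> i * c i = 1 + \<gamma> i\<close> forces
  \<open>u i = c i * \<delta>\<close>.\<close>

lemma others_fixed_iff:
  "(\<forall>k. k \<noteq> i \<longrightarrow> bid_fun k (truthful v k (s k) A) z = z k) \<longleftrightarrow> (\<exists>\<delta>. z = shifted s i A \<delta>)"
proof -
  define u where "u = (\<lambda>j. z j - v j A (\<lambda>l. s l A))"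
  define U where "U = (\<Sum>j\<in>UNIV. \<gamma> j * u j)"
  have fixed: "bid_fun k (truthful v k (s k) A) z = z k \<longleftrightarrow> (1 + \<Gamma>) * u k = U" for k
  proof -
    have "(\<Sum>j\<in>UNIV - {k}. truthful v k (s k) A j * u j) = (\<Sum>j\<in>UNIV - {k}. \<gamma> j * u j) / (1 + \<Gamma> - \<gamma> k)"
      unfolding sum_divide_distrib
      by (rule sum.cong) (auto simp: truthful_slope slope_def)
    also have "\<dots> = (U - \<gamma> k * u k) / (1 + \<Gamma> - \<gamma> k)"
      by (simp add: U_def sum_but_one)
    finally have "bid_fun k (truthful v k (s k) A) z
        = v k A (\<lambda>l. s l A) + (U - \<gamma> k * u k) / (1 + \<Gamma> - \<gamma> k)"
      by (subst bid_fun_diff[where y = "\<lambda>j. v j A (\<lambda>l. s l A)"]) (simp add: bid_fun_truthful u_def)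
    then have "bid_fun k (truthful v k (s k) A) z = z k \<longleftrightarrow> (U - \<gamma> k * u k) / (1 + \<Gamma> - \<gamma> k) = u k"
      by (auto simp: u_def)
    then show ?thesis
      using denom_pos[of k] by (auto simp: field_simps)
  qed
  have \<gamma>c: "\<gamma> i * c i = 1 + \<gamma> i"
    using \<gamma>_c[of i] by (simp add: algebra_simps)
  have rest: "(\<Sum>j\<in>UNIV - {i}. \<gamma> j * u j) = (\<Gamma> - \<gamma> i) * \<delta>" if "\<And>j. j \<noteq> i \<Longrightarrow> u j = \<delta>" for \<delta>
  proof -
    have "(\<Sum>j\<in>UNIV - {i}. \<gamma> j * u j) = (\<Sum>j\<in>UNIV - {i}. \<gamma> j * \<delta>)"
      by (rule sum.cong) (auto simp: that)
    also have "\<dots> = (\<Gamma> - \<gamma> i) * \<delta>"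
      unfolding \<Gamma>_def sum_but_one[of \<gamma>, symmetric] sum_distrib_right ..
    finally show ?thesis .
  qed
  show ?thesis
    unfolding fixed
  proof
    assume eq: "\<forall>k. k \<noteq> i \<longrightarrow> (1 + \<Gamma>) * u k = U"
    define \<delta> where "\<delta> = U / (1 + \<Gamma>)"
    have u\<delta>: "u j = \<delta>" if "j \<noteq> i" for j
      using eq that \<Gamma>_pos by (simp add: \<delta>_def field_simps)
    have "U - \<gamma> i * u i = (\<Gamma> - \<gamma> i) * \<delta>"
      using rest[of \<delta>, OF u\<delta>] by (simp add: U_def sum_but_one)
    moreover have "U = (1 + \<Gamma>) * \<delta>"
      using \<Gamma>_pos by (simp add: \<delta>_def)
    ultimately have "\<gamma> i * u i = \<gamma> i * (c i * \<delta>)"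
      using \<gamma>c by algebra
    then have "u i = c i * \<delta>"
      using \<gamma>_pos[of i] by simp
    then have "z = shifted s i A \<delta>"
      using u\<delta> by (auto simp: fun_eq_iff shifted_def u_def algebra_simps)
    then show "\<exists>\<delta>. z = shifted s i A \<delta>" ..
  next
    assume "\<exists>\<delta>. z = shifted s i A \<delta>"
    then obtain \<delta> where z: "z = shifted s i A \<delta>" ..
    have u: "u j = (if j = i then c i else 1) * \<delta>" for j
      by (simp add: u_def z shifted_def)
    have "U - \<gamma> i * u i = (\<Gamma> - \<gamma> i) * \<delta>"
      using rest[of \<delta>] u by (simp only: U_def sum_but_one if_False mult_1)
    then have "U = (1 + \<Gamma>) * \<delta>"
      using \<gamma>c u[of i] by (simp) algebra
    then show "\<forall>k. k \<noteq> i \<longrightarrow> (1 + \<Gamma>) * u k = U"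
      by (simp add: u)
  qed
qed

lemma fixed_point_iff:
  assumes "\<And>k. k \<noteq> i \<Longrightarrow> y k = truthful v k (s k) A"
  shows "is_fixed_point y z \<longleftrightarrow> (\<exists>\<delta>. z = shifted s i A \<delta>) \<and> bid_fun i (y i) z = z i"
  unfolding others_fixed_iff[symmetric] is_fixed_point_def using assms by metis

text \<open>On the line, the equation of buyer \<open>i\<close> is linear in \<open>\<delta>\<close>
  with leading coefficient \<open>c i - ?X\<close>, which is positive because
  \<open>?X < 1 < c i\<close>.\<close>

lemma ex1_fixed_point:
  assumes others: "\<And>k. k \<noteq> i \<Longrightarrow> x k = truthful v k (s k)" and sold: "goods_sold x"
  shows "\<exists>!z. is_fixed_point (\<lambda>k. x k A) z"
proof -
  let ?u = "\<lambda>j. v j A (\<lambda>l. s l A)"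
  let ?X = "\<Sum>j\<in>UNIV - {i}. x i A j"
  have X: "c i - ?X > 0"
    using goods_sold_sum_less_1[OF sold, of i A] c_gt_1[of i] by simp
  have "bid_fun i (x i A) (shifted s i A \<delta>) = shifted s i A \<delta> i \<longleftrightarrow>
      \<delta> = (bid_fun i (x i A) ?u - ?u i) / (c i - ?X)" for \<delta>
  proof -
    have "(\<Sum>j\<in>UNIV - {i}. x i A j * (shifted s i A \<delta> j - ?u j)) = (\<Sum>j\<in>UNIV - {i}. x i A j * \<delta>)"
      by (rule sum.cong) (auto simp: shifted_def)
    also have "\<dots> = ?X * \<delta>"
      by (simp add: sum_distrib_right)
    finally have "bid_fun i (x i A) (shifted s i A \<delta>) = bid_fun i (x i A) ?u + ?X * \<delta>"
      by (subst bid_fun_diff[where y = ?u]) simp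
    then show ?thesis
      using X by (auto simp: shifted_def field_simps)
  qed
  then have "is_fixed_point (\<lambda>k. x k A) z \<longleftrightarrow>
      z = shifted s i A ((bid_fun i (x i A) ?u - ?u i) / (c i - ?X))" for z
    using others by (subst fixed_point_iff[of i _ s]) auto
  then show ?thesis
    by simp
qed

lemma reported_value_shifted:
  assumes "\<And>k. k \<noteq> i \<Longrightarrow> x k = truthful v k (s k)" "goods_sold x"
  obtains \<delta> where "\<And>j A. reported_value x j A = shifted s i A (\<delta> A) j"
proof -
  have "\<exists>\<delta>. \<forall>j. reported_value x j A = shifted s i A \<delta> j" for A
  proof -
    have "is_fixed_point (\<lambda>k. x k A) (\<lambda>j. reported_value x j A)"
      unfolding reported_value_def by (rule theI'[OF ex1_fixed_point[of i x s]]) (simp_all add: assms)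
    then have "\<exists>\<delta>. (\<lambda>j. reported_value x j A) = shifted s i A \<delta>"
      using assms(1) by (subst (asm) fixed_point_iff[of i _ s]) auto
    then show ?thesis
      by (metis (no_types))
  qed
  then show thesis
    using that by metis
qed

lemma reported_value_truthful:
  "reported_value (\<lambda>k. truthful v k (s k)) = (\<lambda>j A. v j A (\<lambda>l. s l A))"
proof (intro ext)
  fix j A
  let ?x = "\<lambda>k. truthful v k (s k)"
  have "is_fixed_point (\<lambda>k. ?x k A) (\<lambda>j. v j A (\<lambda>l. s l A))"
    by (simp add: is_fixed_point_def bid_fun_truthful)
  \<comment> \<open>With all bids truthful, any buyer can play the part of the possible deviator,
    hence \<open>undefined\<close>.\<close>
  then have "(THE z. is_fixed_point (\<lambda>k. ?x k A) z) = (\<lambda>j. v j A (\<lambda>l. s l A))"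
    using ex1_fixed_point[of undefined ?x s A] goods_sold_truthful by (auto intro: the1_equality)
  then show "reported_value ?x j A = v j A (\<lambda>l. s l A)"
    by (simp add: reported_value_def)
qed

lemma optimal_without_buyer:
  assumes "\<And>k. k \<noteq> i \<Longrightarrow> x k = truthful v k (s k)" "goods_sold x"
  shows "optimal_assignment (UNIV - {i}) (reported_value x) a \<longleftrightarrow>
         optimal_assignment (UNIV - {i}) (\<lambda>j A. v j A (\<lambda>l. s l A)) a"
proof -
  obtain \<delta> where "\<And>j A. reported_value x j A = shifted s i A (\<delta> A) j"
    using reported_value_shifted[of i x s] assms by blast
  then show ?thesis
    by (intro optimal_assignment_shift[where r = \<delta>]) (auto simp: shifted_def)
qed

section \<open>Price and utility\<close>

text \<open>Moving by \<open>r\<close> along the line changes the value of \<open>i\<close> by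
  \<open>c i * r\<close> and that of the buyer replacing \<open>i\<close> at \<open>A\<close> by
  \<open>r\<close>. The remaining goods contribute true values plus shifts common to both sides, so
  the price equation reduces to \<open>(c i - 1) * r = ?W ?a' - ?W ?a\<close>.\<close>

lemma price_eq:
  fixes \<tau> :: "('b, 'g) selection"
  assumes others: "\<And>k. k \<noteq> i \<Longrightarrow> x k = truthful v k (s k)" and sold: "goods_sold x"
    and a: "inj (\<tau> UNIV x)" "\<tau> UNIV x A = i"
    and a': "range (\<tau> (UNIV - {i}) x) \<subseteq> UNIV - {i}"
  shows "price \<tau> x i A = v i A (\<lambda>l. s l A) - c i / (c i - 1) *
           ((\<Sum>K\<in>UNIV. v (\<tau> UNIV x K) K (\<lambda>l. s l K)) -
            (\<Sum>K\<in>UNIV. v (\<tau> (UNIV - {i}) x K) K (\<lambda>l. s l K)))"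
proof -
  let ?u = "\<lambda>j K. v j K (\<lambda>l. s l K)"
  let ?a = "\<tau> UNIV x" and ?a' = "\<tau> (UNIV - {i}) x"
  let ?W = "\<lambda>b. \<Sum>K\<in>UNIV. ?u (b K) K"
  let ?y = "\<lambda>y. (\<lambda>k. x k A)(i := (x i A)(i := y))"
  obtain \<delta> where \<delta>: "\<And>j K. reported_value x j K = shifted s i K (\<delta> K) j"
    using reported_value_shifted[of i x s] others sold by blast
  have ne: "?a K \<noteq> i" if "K \<noteq> A" for K
    using a that by (metis injD)
  have ne': "?a' K \<noteq> i" for K
    using a' by auto
  \<comment> \<open>Away from \<open>A\<close> no good goes to \<open>i\<close> in either
    assignment, so the shift for good \<open>K\<close> is always \<open>\<delta> K\<close> and never
    \<open>c i * \<delta> K\<close>.\<close>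
  have "(\<Sum>K\<in>UNIV - {A}. reported_value x (b K) K)
      = ?W b - ?u (b A) A + (\<Sum>K\<in>UNIV - {A}. \<delta> K)" if "\<And>K. K \<noteq> A \<Longrightarrow> b K \<noteq> i" for b
    unfolding sum_but_one[of "\<lambda>K. ?u (b K) K", symmetric] sum.distrib[symmetric]
    by (rule sum.cong) (auto simp: \<delta> shifted_def that)
  note rest = this[of ?a, OF ne] this[of ?a', OF ne']
  define \<delta>' where "\<delta>' = (?W ?a' - ?W ?a) / (c i - 1)"
  have indifferent: "shifted s i A r i + (\<Sum>K\<in>UNIV - {A}. reported_value x (?a K) K)
        = shifted s i A r (?a' A) + (\<Sum>K\<in>UNIV - {A}. reported_value x (?a' K) K) \<longleftrightarrow> r = \<delta>'" for r
    using c_gt_1[of i] a(2) ne'[of A]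
    by (auto simp: rest shifted_def \<delta>'_def field_simps)
  \<comment> \<open>The free constant term \<open>y\<close> can satisfy the equation of buyer
    \<open>i\<close> at any \<open>z\<close>; only the equations of the others restrict
    \<open>z\<close>.\<close>
  have line: "(\<exists>y. is_fixed_point (?y y) z) \<longleftrightarrow> (\<exists>r. z = shifted s i A r)" for z
  proof -
    have "\<exists>y. bid_fun i ((x i A)(i := y)) z = z i"
    proof -
      define y where "y = z i - (\<Sum>j\<in>UNIV - {i}. x i A j * z j)"
      have "(\<Sum>j\<in>UNIV - {i}. ((x i A)(i := y)) j * z j) = (\<Sum>j\<in>UNIV - {i}. x i A j * z j)"
        by (rule sum.cong) auto
      then have "bid_fun i ((x i A)(i := y)) z = z i"
        unfolding bid_fun_def by (simp add: y_def)
      then show ?thesis ..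
    qed
    then show ?thesis
      using others by (subst fixed_point_iff[of i _ s]) auto
  qed
  have "price \<tau> x i A = (THE p. \<exists>z. (\<exists>y. is_fixed_point (?y y) z) \<and>
      z i + (\<Sum>K\<in>UNIV - {A}. reported_value x (?a K) K)
        = z (?a' A) + (\<Sum>K\<in>UNIV - {A}. reported_value x (?a' K) K) \<and> p = z i)"
    unfolding price_def Let_def by (rule arg_cong[where f = The]) blast
  also have "\<dots> = (THE p. p = shifted s i A \<delta>' i)"
    unfolding line by (rule arg_cong[where f = The], rule ext) (auto simp: indifferent)
  also have "\<dots> = shifted s i A \<delta>' i"
    by simp
  also have "\<dots> = ?u i A - c i / (c i - 1) * (?W ?a - ?W ?a')"
    using c_gt_1[of i] by (simp add: shifted_def \<delta>'_def field_simps)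
  finally show ?thesis .
qed

lemma utility_auction4:
  assumes others: "\<And>k. k \<noteq> i \<Longrightarrow> x k = truthful v k (s k)" and sold: "goods_sold x"
    and a: "inj (\<tau> UNIV x)"
    and a': "range (\<tau> (UNIV - {i}) x) \<subseteq> UNIV - {i}"
    and empty: "\<And>i s. V i {} s = 0"
    and unit: "\<And>i S s. S \<noteq> {} \<Longrightarrow> V i S s = Max ((\<lambda>K. v i K (\<lambda>j. s j K)) ` S)"
  shows "utility V s (auction4 \<tau> x) i =
    (if i \<in> range (\<tau> UNIV x)
     then c i / (c i - 1) *
           ((\<Sum>K\<in>UNIV. v (\<tau> UNIV x K) K (\<lambda>l. s l K)) -
            (\<Sum>K\<in>UNIV. v (\<tau> (UNIV - {i}) x K) K (\<lambda>l. s l K)))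
     else 0)"
proof (cases "i \<in> range (\<tau> UNIV x)")
  case True
  then obtain A where A: "\<tau> UNIV x A = i" by auto
  with a have "\<tau> UNIV x K = i \<longleftrightarrow> K = A" for K
    by (auto dest: injD)
  moreover have "price \<tau> x i A = v i A (\<lambda>l. s l A) - c i / (c i - 1) *
           ((\<Sum>K\<in>UNIV. v (\<tau> UNIV x K) K (\<lambda>l. s l K)) -
            (\<Sum>K\<in>UNIV. v (\<tau> (UNIV - {i}) x K) K (\<lambda>l. s l K)))"
    by (rule price_eq[where \<tau> = \<tau>]) (use others sold a A a' in auto)
  ultimately show ?thesis
    using True sold unit_demand_singleton[of V v, OF unit]
    by (simp add: utility_def auction4_def)
next
  case False
  then have "\<nexists>K. \<tau> UNIV x K = i" by auto
  then show ?thesis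
    using False sold by (simp add: utility_def auction4_def empty)
qed

section \<open>Equilibrium and efficiency\<close>

lemma nash_equilibrium_auction4:
  fixes \<tau> :: "('b, 'g) selection"
  assumes card: "CARD('g) < CARD('b)"
    and empty: "\<And>i s. V i {} s = 0"
    and unit: "\<And>i S s. S \<noteq> {} \<Longrightarrow> V i S s = Max ((\<lambda>K. v i K (\<lambda>j. s j K)) ` S)"
    and sel: "selection_rule \<tau>"
  shows "nash_equilibrium (auction4 \<tau>) V T (truthful v)"
  unfolding nash_equilibrium_def
proof (intro ballI allI)
  fix s i and b :: "('b, 'g) bid"
  define x where "x = (\<lambda>k. truthful v k (s k))"
  define x' where "x' = x(i := b)"
  let ?u = "\<lambda>j K. v j K (\<lambda>l. s l K)"
  let ?W = "\<lambda>a. \<Sum>K\<in>UNIV. ?u (a K) K"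
  let ?C = "c i / (c i - 1)"
  have C: "?C > 0"
    using c_gt_1[of i] by simp
  have others: "k \<noteq> i \<Longrightarrow> x k = truthful v k (s k)" "k \<noteq> i \<Longrightarrow> x' k = truthful v k (s k)" for k
    by (simp_all add: x_def x'_def)
  have sold: "goods_sold x"
    unfolding x_def by (rule goods_sold_truthful)
  have sel_all: "optimal_assignment UNIV (reported_value y) (\<tau> UNIV y)" for y
    using sel card by (simp add: selection_rule_def)
  have sel_but_i: "optimal_assignment (UNIV - {i}) (reported_value y) (\<tau> (UNIV - {i}) y)" for y
    using sel card by (simp add: selection_rule_def card_Diff_subset)
  have opt: "optimal_assignment UNIV ?u (\<tau> UNIV x)"
    using sel_all[of x] by (simp add: x_def reported_value_truthful)
  have opt_but_i: "optimal_assignment (UNIV - {i}) ?u (\<tau> (UNIV - {i}) y)"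
    if "goods_sold y" "\<And>k. k \<noteq> i \<Longrightarrow> y k = truthful v k (s k)" for y
    using sel_but_i[of y] optimal_without_buyer[of i y s, OF that(2,1)] by simp
  note opt_i = opt_but_i[of x, OF sold others(1)]
  have inj: "inj (\<tau> UNIV y)" and range: "range (\<tau> (UNIV - {i}) y) \<subseteq> UNIV - {i}" for y
    using sel_all sel_but_i unfolding optimal_assignment_iff by blast+
  have util: "utility V s (auction4 \<tau> y) i =
      (if i \<in> range (\<tau> UNIV y) then ?C * (?W (\<tau> UNIV y) - ?W (\<tau> (UNIV - {i}) y)) else 0)"
    if "goods_sold y" "\<And>k. k \<noteq> i \<Longrightarrow> y k = truthful v k (s k)" for y
    by (rule utility_auction4[where \<tau> = \<tau>, OF _ _ inj range empty unit]) (use that in auto)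
  have le: "?W (\<tau> (UNIV - {i}) x) \<le> ?W (\<tau> UNIV x)"
    using opt opt_i by (simp add: optimal_assignment_iff)
  \<comment> \<open>If \<open>i\<close> wins nothing, the chosen assignment also competes among
    those without \<open>i\<close>. The two welfares then agree, and the winning formula gives the
    correct utility 0 in this case too.\<close>
  have "?W (\<tau> UNIV x) \<le> ?W (\<tau> (UNIV - {i}) x)" if "i \<notin> range (\<tau> UNIV x)"
    using opt_i that inj[of x] by (auto simp: optimal_assignment_iff)
  with le have util_x: "utility V s (auction4 \<tau> x) i
      = ?C * (?W (\<tau> UNIV x) - ?W (\<tau> (UNIV - {i}) x))"
    using util[of x, OF sold others(1)] by auto
  then have nonneg: "utility V s (auction4 \<tau> x) i \<ge> 0"
    using C le unfolding util_x by (intro mult_nonneg_nonneg) auto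
  have "utility V s (auction4 \<tau> x') i \<le> utility V s (auction4 \<tau> x) i"
  proof (cases "goods_sold x' \<and> i \<in> range (\<tau> UNIV x')")
    case True
    then have opt_i': "optimal_assignment (UNIV - {i}) ?u (\<tau> (UNIV - {i}) x')"
      using opt_but_i others(2) by blast
    \<comment> \<open>The subtracted term is beyond the control of buyer \<open>i\<close>: both
      assignments are optimal without \<open>i\<close> for the true values, even if they
      differ.\<close>
    have "?W (\<tau> (UNIV - {i}) x') = ?W (\<tau> (UNIV - {i}) x)"
      using opt_i opt_i' by (auto simp: optimal_assignment_iff intro: antisym)
    moreover have "?W (\<tau> UNIV x') \<le> ?W (\<tau> UNIV x)"
      using opt inj[of x'] by (simp add: optimal_assignment_iff)
    ultimately have "?C * (?W (\<tau> UNIV x') - ?W (\<tau> (UNIV - {i}) x'))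
        \<le> ?C * (?W (\<tau> UNIV x) - ?W (\<tau> (UNIV - {i}) x))"
      using C by (intro mult_left_mono) auto
    then show ?thesis
      unfolding util_x using True util[of x', OF _ others(2)] by simp
  next
    case False
    \<comment> \<open>A deviation that blocks the sale or wins nothing yields 0, which truthful
      bidding already guarantees.\<close>
    then have "utility V s (auction4 \<tau> x') i = 0"
      using util[of x', OF _ others(2)] by (auto simp: utility_def auction4_def empty)
    with nonneg show ?thesis by simp
  qed
  then show "utility V s (auction4 \<tau> ((\<lambda>k. truthful v k (s k))(i := b))) i
      \<le> utility V s (auction4 \<tau> (\<lambda>k. truthful v k (s k))) i"
    by (simp add: x_def x'_def)
qed

lemma truthful_allocation_optimal:
  fixes \<tau> :: "('b, 'g) selection"
  assumes card: "CARD('g) < CARD('b)"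
    and empty: "\<And>i s. V i {} s = 0"
    and unit: "\<And>i S s. S \<noteq> {} \<Longrightarrow> V i S s = Max ((\<lambda>K. v i K (\<lambda>j. s j K)) ` S)"
    and sel: "selection_rule \<tau>"
    and nonneg: "\<And>i S. V i S s \<ge> 0"
  shows "is_arg_max (welfare V s) disjoint_family
           (fst (auction4 \<tau> (\<lambda>k. truthful v k (s k))))"
proof -
  let ?x = "\<lambda>k. truthful v k (s k)"
  have "optimal_assignment UNIV (\<lambda>j A. v j A (\<lambda>l. s l A)) (\<tau> UNIV ?x)"
    using sel card unfolding selection_rule_def reported_value_truthful[symmetric] by simp
  then show ?thesis
    using optimal_assignment_welfare[of V v s, OF empty unit _ nonneg] card
    by (simp add: auction4_def goods_sold_truthful)
qed

end

theorem theorem5p5: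
  fixes w f :: "'b::finite \<Rightarrow> real \<Rightarrow> real"
    and v :: "'b \<Rightarrow> 'g::finite \<Rightarrow> ('b \<Rightarrow> real) \<Rightarrow> real"
    and V :: "('b, 'g) set_valuation"
    and \<tau> :: "('b, 'g) selection"
  assumes more_buyers: "CARD('b) > CARD('g)"
    and w_linear: "\<And>i. linear_fun (w i)"
    and f_linear: "\<And>i. linear_fun (f i)"
    and w_incr: "\<And>i. strict_mono (w i)"
    and empty_set: "\<And>i s. V i {} s = 0"
    and unit_demand: "\<And>i S s. S \<noteq> {} \<Longrightarrow> V i S s = Max ((\<lambda>K. v i K (\<lambda>j. s j K)) ` S)"
    and valuation: "\<And>i K t. v i K t = w i (t i) + (\<Sum>j\<in>UNIV - {i}. f j (t j))"
    and deriv_gt: "\<And>i x. deriv (w i) x > deriv (f i) x"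
    and proportional: "\<And>i. \<exists>c>1. \<exists>d. \<forall>x. w i x = c * f i x + d"
    and f_inj: "\<And>i. inj (f i)"
    and f_image: "\<And>i. range (f i) = UNIV"
    and selection: "selection_rule \<tau>"
  shows "nash_equilibrium (auction4 \<tau>) V {s. \<forall>i S. V i S s \<ge> 0} (truthful v) \<and>
         efficient (auction4 \<tau>) V {s. \<forall>i S. V i S s \<ge> 0}"
proof -
  obtain c d where cd: "\<And>i. c i > 1 \<and> (\<forall>x. w i x = c i * f i x + d i)"
    using proportional by metis
  interpret proportional_valuations f c d v
    using cd f_image valuation by unfold_locales auto
  have "nash_equilibrium (auction4 \<tau>) V {s. \<forall>i S. V i S s \<ge> 0} (truthful v)"
    by (rule nash_equilibrium_auction4[OF more_buyers empty_set unit_demand selection])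
  moreover have "is_arg_max (welfare V s) disjoint_family
      (fst (auction4 \<tau> (\<lambda>k. truthful v k (s k))))" if "\<forall>i S. V i S s \<ge> 0" for s
    using that by (intro truthful_allocation_optimal more_buyers empty_set unit_demand selection) auto
  ultimately show ?thesis
    unfolding efficient_def by blast
qed

end
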